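(* Let $(S,A,\to)$ be an NPLTS and $s_1,s_2\in S$. If $s_1\sim_{\mathrm{PTe}\text{-}\forall\exists}s_2$, then $s_1\sim_{\mathrm{PTr}}s_2$.
   Context: An NPLTS is a triple $(S,A,\to)$ where $S$ is an at most countable set of states, $A$ a countable set of actions, and $\to\subseteq S\times A\times\mathrm{Distr}(S)$ ($\mathrm{Distr}(S)$ = discrete probability distributions over $S$); write $s\xrightarrow{a}\mathcal D$, $\mathrm{supp}(\mathcal D)=\{s'\mid\mathcal D(s')>0\}$. A computation from $s_0$ is a sequence $s_0\xrightarrow{a_1}s_1\cdots\xrightarrow{a_n}s_n$ with transitions $s_{i-1}\xrightarrow{a_i}\mathcal D_i$, $s_i\in\mathrm{supp}(\mathcal D_i)$; it is compatible with $\alpha\in A^*$ if $a_1\cdots a_n=\alpha$. A resolution of a state $x$ (deterministic scheduler) is an NPLTS $\mathcal Z=(Z,A,\to_{\mathcal Z})$, obtained by unfolding from a state $z_x$, with $\mathrm{corr}$ mapping $Z$ to states, $\mathrm{corr}(z_x)=x$, such that for all $z$: (i) if $z\xrightarrow{a}_{\mathcal Z}\mathcal D$ then $\mathrm{corr}(z)\xrightarrow{a}\mathcal D'$ with $\mathcal D(z')=\mathcal D'(\mathrm{corr}(z'))$ for all $z'$; (ii) $z$ has at most one outgoing transition; maximal if it cannot be further extended in accordance with the graph structure and these constraints. $\mathrm{Res}(s)$ is the set of resolutions of $s$. $\mathrm{prob}(c)$ is the product of step probabilities of a finite computation in $\mathcal Z$, summed over sets of computations none a proper prefix of another; $\mathcal{CC}(z_s,\alpha)$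 is the set of $\alpha$-compatible finite computations from $z_s$. $s_1\sim_{\mathrm{PTr}}s_2$ iff for all $\alpha\in A^*$: for each $\mathcal Z_1\in\mathrm{Res}(s_1)$ there is $\mathcal Z_2\in\mathrm{Res}(s_2)$ with $\mathrm{prob}(\mathcal{CC}(z_{s_1},\alpha))=\mathrm{prob}(\mathcal{CC}(z_{s_2},\alpha))$, and symmetrically. An NPT is a finite, acyclic NPLTS $\mathcal T=(O,A,\to_{\mathcal T})$ with a distinguished success state $\omega$ without outgoing transitions. The interaction system of $(S,A,\to)$ and $\mathcal T$ is the NPLTS on $S\times O$ with $(s,o)\xrightarrow{a}\mathcal D$ iff $s\xrightarrow{a}\mathcal D_1$, $o\xrightarrow{a}_{\mathcal T}\mathcal D_2$, $\mathcal D(s',o')=\mathcal D_1(s')\mathcal D_2(o')$. A computation is successful if its last configuration is $(s',\omega)$ for some $s'$. $\mathrm{Res}_{\max}(s,o)$ is the set of maximal resolutions of $(s,o)$ in the interaction system; $\mathcal{SC}(z_{s,o})$ the set of successful computations from $z_{s,o}$. $s_1\sim_{\mathrm{PTe}\text{-}\forall\exists}s_2$ iff for every NPT with initial state $o$: for each $\mathcal Z_1\in\mathrm{Res}_{\max}(s_1,o)$ there is $\mathcal Z_2\in\mathrm{Res}_{\max}(s_2,o)$ with $\mathrm{prob}(\mathcal{SC}(z_{s_1,o}))=\mathrm{prob}(\mathcal{SC}(z_{s_2,o}))$, and symmetrically. *)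

theory Defs
  imports "HOL-Probability.Probability_Mass_Function"
begin

record ('s, 'a) nplts =
  states :: "'s set"
  actions :: "'a set"
  transitions :: "('s \<times> 'a \<times> 's pmf) set"

definition is_nplts :: "('s, 'a) nplts \<Rightarrow> bool" where
  "is_nplts L \<longleftrightarrow> countable (states L) \<and> countable (actions L) \<and>
     transitions L \<subseteq> states L \<times> actions L \<times> {D. set_pmf D \<subseteq> states L}"

text \<open>A finite computation \<open>s\<^sub>0 -a\<^sub>1\<rightarrow> s\<^sub>1 \<dots> -a\<^sub>n\<rightarrow> s\<^sub>n\<close> is encoded as its starting state \<open>s\<^sub>0\<close>
  together with the list \<open>[(a\<^sub>1, s\<^sub>1), \<dots>, (a\<^sub>n, s\<^sub>n)]\<close>.\<close>

fun is_computation :: "('s, 'a) nplts \<Rightarrow> 's \<Rightarrow> ('a \<times> 's) list \<Rightarrow> bool" where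
  "is_computation L s [] \<longleftrightarrow> True"
| "is_computation L s ((a, s') # c) \<longleftrightarrow>
     (\<exists>D. (s, a, D) \<in> transitions L \<and> s' \<in> set_pmf D) \<and> is_computation L s' c"

definition final_state :: "'s \<Rightarrow> ('a \<times> 's) list \<Rightarrow> 's" where
  "final_state s c = last (s # map snd c)"

definition compatible :: "('a \<times> 's) list \<Rightarrow> 'a list \<Rightarrow> bool" where
  "compatible c \<alpha> \<longleftrightarrow> map fst c = \<alpha>"

text \<open>Only meaningful in resolutions, where the transition leaving a state is unique.\<close>

fun comp_prob :: "('s, 'a) nplts \<Rightarrow> 's \<Rightarrow> ('a \<times> 's) list \<Rightarrow> real" where
  "comp_prob Z z [] = 1"
| "comp_prob Z z ((a, z') # c) =
     pmf (THE D. (z, a, D) \<in> transitions Z) z' * comp_prob Z z' c"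

text \<open>Used only for sets of computations none of which is a proper prefix of another; over a
  resolution this sum always converges, to a value of at most 1.\<close>

definition prob :: "('s, 'a) nplts \<Rightarrow> 's \<Rightarrow> ('a \<times> 's) list set \<Rightarrow> real" where
  "prob Z z C = (\<Sum>\<^sub>\<infinity>c\<in>C. comp_prob Z z c)"

text \<open>A resolution of \<open>x\<close> is given by the system \<open>Z\<close>, its root \<open>z\<^sub>x\<close> and the correspondence
  function. That \<open>Z\<close> is obtained by unfolding from \<open>z\<^sub>x\<close> is expressed by two conditions:
  every state is reached by exactly one computation from the root (so \<open>Z\<close> is a tree), and the
  support of a transition of \<open>Z\<close> contains exactly one copy of each state in the support of the
  transition it stems from. The equation \<open>D(z') = D'(corr z')\<close> ranges over these copies; states
  elsewhere in the tree may correspond to the same original state and have probability 0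
  under \<open>D\<close>.\<close>

definition is_resolution ::
  "('s, 'a) nplts \<Rightarrow> 's \<Rightarrow> ('z, 'a) nplts \<Rightarrow> 'z \<Rightarrow> ('z \<Rightarrow> 's) \<Rightarrow> bool" where
  "is_resolution L x Z zx corr \<longleftrightarrow>
     is_nplts Z \<and> actions Z = actions L \<and> zx \<in> states Z \<and>
     corr ` states Z \<subseteq> states L \<and> corr zx = x \<and>
     (\<forall>z\<in>states Z. \<exists>!c. is_computation Z zx c \<and> final_state zx c = z) \<and>
     (\<forall>z a D. (z, a, D) \<in> transitions Z \<longrightarrow>
        (\<exists>D'. (corr z, a, D') \<in> transitions L \<and>
              bij_betw corr (set_pmf D) (set_pmf D') \<and>
              (\<forall>z'\<in>set_pmf D. pmf D z' = pmf D' (corr z')))) \<and>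
     (\<forall>z a\<^sub>1 D\<^sub>1 a\<^sub>2 D\<^sub>2. (z, a\<^sub>1, D\<^sub>1) \<in> transitions Z \<longrightarrow> (z, a\<^sub>2, D\<^sub>2) \<in> transitions Z \<longrightarrow>
        a\<^sub>1 = a\<^sub>2 \<and> D\<^sub>1 = D\<^sub>2)"

text \<open>Since state spaces are at most countable, every resolution is isomorphic to one whose states
  are natural numbers.\<close>

type_synonym ('s, 'a) resolution = "(nat, 'a) nplts \<times> nat \<times> (nat \<Rightarrow> 's)"

definition Res :: "('s, 'a) nplts \<Rightarrow> 's \<Rightarrow> ('s, 'a) resolution set" where
  "Res L x = {(Z, zx, corr). is_resolution L x Z zx corr}"

definition rename_states :: "('z \<Rightarrow> 'y) \<Rightarrow> ('z, 'a) nplts \<Rightarrow> ('y, 'a) nplts" where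
  "rename_states h Z = \<lparr>states = h ` states Z, actions = actions Z,
     transitions = (\<lambda>(z, a, D). (h z, a, map_pmf h D)) ` transitions Z\<rparr>"

text \<open>Extensions are considered up to an injective renaming \<open>h\<close>, so that a resolution using up all
  natural numbers as states is not maximal merely for lack of fresh states.\<close>

fun extends_via ::
  "(nat \<Rightarrow> nat) \<Rightarrow> ('s, 'a) resolution \<Rightarrow> ('s, 'a) resolution \<Rightarrow> bool" where
  "extends_via h (Z, z, corr) (Z', z', corr') \<longleftrightarrow>
     inj_on h (states Z) \<and> h z = z' \<and> (\<forall>y\<in>states Z. corr' (h y) = corr y) \<and>
     states (rename_states h Z) \<subseteq> states Z' \<and>
     transitions (rename_states h Z) \<subseteq> transitions Z'"

definition Res_max :: "('s, 'a) nplts \<Rightarrow> 's \<Rightarrow> ('s, 'a) resolution set" where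
  "Res_max L x = {R \<in> Res L x. \<forall>R'\<in>Res L x. \<forall>h.
     extends_via h R R' \<longrightarrow> fst R' = rename_states h (fst R)}"

definition CC :: "('z, 'a) nplts \<Rightarrow> 'z \<Rightarrow> 'a list \<Rightarrow> ('a \<times> 'z) list set" where
  "CC Z z \<alpha> = {c. is_computation Z z c \<and> compatible c \<alpha>}"

definition PTr :: "('s, 'a) nplts \<Rightarrow> 's \<Rightarrow> 's \<Rightarrow> bool" where
  "PTr L s\<^sub>1 s\<^sub>2 \<longleftrightarrow> (\<forall>\<alpha>\<in>lists (actions L).
     (\<forall>(Z\<^sub>1, z\<^sub>1, corr\<^sub>1)\<in>Res L s\<^sub>1. \<exists>(Z\<^sub>2, z\<^sub>2, corr\<^sub>2)\<in>Res L s\<^sub>2.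
        prob Z\<^sub>1 z\<^sub>1 (CC Z\<^sub>1 z\<^sub>1 \<alpha>) = prob Z\<^sub>2 z\<^sub>2 (CC Z\<^sub>2 z\<^sub>2 \<alpha>)) \<and>
     (\<forall>(Z\<^sub>2, z\<^sub>2, corr\<^sub>2)\<in>Res L s\<^sub>2. \<exists>(Z\<^sub>1, z\<^sub>1, corr\<^sub>1)\<in>Res L s\<^sub>1.
        prob Z\<^sub>2 z\<^sub>2 (CC Z\<^sub>2 z\<^sub>2 \<alpha>) = prob Z\<^sub>1 z\<^sub>1 (CC Z\<^sub>1 z\<^sub>1 \<alpha>)))"

definition is_npt :: "('o, 'a) nplts \<Rightarrow> 'o \<Rightarrow> bool" where
  "is_npt T \<omega> \<longleftrightarrow> is_nplts T \<and> finite (states T) \<and> finite (transitions T) \<and>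
     acyclic {(q, q'). \<exists>a D. (q, a, D) \<in> transitions T \<and> q' \<in> set_pmf D} \<and>
     \<omega> \<in> states T \<and> (\<forall>a D. (\<omega>, a, D) \<notin> transitions T)"

definition interaction :: "('s, 'a) nplts \<Rightarrow> ('o, 'a) nplts \<Rightarrow> ('s \<times> 'o, 'a) nplts" where
  "interaction L T = \<lparr>states = states L \<times> states T, actions = actions L,
     transitions = {((s, q), a, pair_pmf D\<^sub>1 D\<^sub>2) | s q a D\<^sub>1 D\<^sub>2.
       (s, a, D\<^sub>1) \<in> transitions L \<and> (q, a, D\<^sub>2) \<in> transitions T}\<rparr>"

definition SC ::
  "('z, 'a) nplts \<Rightarrow> 'z \<Rightarrow> ('z \<Rightarrow> 's \<times> 'o) \<Rightarrow> 'o \<Rightarrow> ('a \<times> 'z) list set" where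
  "SC Z z corr \<omega> = {c. is_computation Z z c \<and> (\<exists>s'. corr (final_state z c) = (s', \<omega>))}"

text \<open>As tests are finite, natural numbers suffice as test states up to isomorphism.\<close>

definition PTe_forall_exists :: "('s, 'a) nplts \<Rightarrow> 's \<Rightarrow> 's \<Rightarrow> bool" where
  "PTe_forall_exists L s\<^sub>1 s\<^sub>2 \<longleftrightarrow>
     (\<forall>(T :: (nat, 'a) nplts) \<omega> q. is_npt T \<omega> \<and> actions T = actions L \<and> q \<in> states T \<longrightarrow>
       (\<forall>(Z\<^sub>1, z\<^sub>1, corr\<^sub>1)\<in>Res_max (interaction L T) (s\<^sub>1, q).
        \<exists>(Z\<^sub>2, z\<^sub>2, corr\<^sub>2)\<in>Res_max (interaction L T) (s\<^sub>2, q).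
          prob Z\<^sub>1 z\<^sub>1 (SC Z\<^sub>1 z\<^sub>1 corr\<^sub>1 \<omega>) = prob Z\<^sub>2 z\<^sub>2 (SC Z\<^sub>2 z\<^sub>2 corr\<^sub>2 \<omega>)) \<and>
       (\<forall>(Z\<^sub>2, z\<^sub>2, corr\<^sub>2)\<in>Res_max (interaction L T) (s\<^sub>2, q).
        \<exists>(Z\<^sub>1, z\<^sub>1, corr\<^sub>1)\<in>Res_max (interaction L T) (s\<^sub>1, q).
          prob Z\<^sub>2 z\<^sub>2 (SC Z\<^sub>2 z\<^sub>2 corr\<^sub>2 \<omega>) = prob Z\<^sub>1 z\<^sub>1 (SC Z\<^sub>1 z\<^sub>1 corr\<^sub>1 \<omega>)))"

end

theory Submission imports Defs begin

text \<open>For a trace of length \<open>n\<close> take the chain-shaped test that at position \<open>i < n\<close> offers the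
  \<open>i\<close>-th action twice: once leading to position \<open>i + 1\<close> and once leading to a dead state. Success is
  position \<open>n\<close>. A resolution of a process that stops, or deviates from the trace, is matched by a
  maximal resolution of the interaction system that moves to the dead state of the test instead;
  conversely, cutting the transitions into the dead state turns a resolution of the interaction
  system into one of the process. Both translations preserve the computations that perform the
  whole trace, together with their probabilities.\<close>

section \<open>Computations and trees\<close>

lemma final_state_simps [simp]:
  "final_state s [] = s"
  "final_state s ((a, y) # c) = final_state y c"
  "final_state s (c @ [(a, y)]) = y"
  by (auto simp: final_state_def)

lemma is_computation_append:
  "is_computation L s (c @ d) \<longleftrightarrow> is_computation L s c \<and> is_computation L (final_state s c) d"
  by (induction L s c rule: is_computation.induct) auto

lemma is_computation_snoc:
  "is_computation L s (c @ [(a, y)]) \<longleftrightarrow>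
     is_computation L s c \<and> (\<exists>D. (final_state s c, a, D) \<in> transitions L \<and> y \<in> set_pmf D)"
  by (simp add: is_computation_append)

lemma is_npltsD:
  assumes "is_nplts L" "(s, a, D) \<in> transitions L"
  shows "s \<in> states L" "a \<in> actions L" "set_pmf D \<subseteq> states L"
  using assms by (auto simp: is_nplts_def)

lemma final_state_in_states:
  assumes "is_nplts L" "s \<in> states L" "is_computation L s c"
  shows "final_state s c \<in> states L"
  using assms(2,3)
proof (induction c arbitrary: s)
  case (Cons x c)
  then show ?case using is_npltsD(3)[OF assms(1)] by (cases x) fastforce
qed simp

lemma comp_prob_Cons:
  assumes "(z, a, D) \<in> transitions Z"
    and "\<And>D'. (z, a, D') \<in> transitions Z \<Longrightarrow> D' = D"
  shows "comp_prob Z z ((a, y) # c) = pmf D y * comp_prob Z y c"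
proof -
  have "(THE D. (z, a, D) \<in> transitions Z) = D"
    using assms by blast
  then show ?thesis by simp
qed

text \<open>Turns the global tree condition into local ones on single transitions. Uniqueness
  follows by tracing a computation backwards from its end. The equation \<open>D = D'\<close> is
  absent because a computation records only actions and states, not distributions.\<close>

lemma unique_computation_iff:
  assumes "is_nplts Z" "r \<in> states Z"
  shows "(\<forall>z\<in>states Z. \<exists>!c. is_computation Z r c \<and> final_state r c = z) \<longleftrightarrow>
    (\<forall>z\<in>states Z. \<exists>c. is_computation Z r c \<and> final_state r c = z) \<and>
    (\<forall>z a D. (z, a, D) \<in> transitions Z \<longrightarrow> r \<notin> set_pmf D) \<and>
    (\<forall>z a D z' a' D'. (z, a, D) \<in> transitions Z \<longrightarrow> (z', a', D') \<in> transitions Z \<longrightarrow>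
       set_pmf D \<inter> set_pmf D' \<noteq> {} \<longrightarrow> z = z' \<and> a = a')"
    (is "?unique \<longleftrightarrow> ?reach \<and> ?root \<and> ?pred")
proof (intro iffI conjI)
  assume u: ?unique
  then show reach: ?reach by blast
  have path: "\<exists>c. is_computation Z r (c @ [(a, y)]) \<and> final_state r c = z"
    if "(z, a, D) \<in> transitions Z" "y \<in> set_pmf D" for z a D y
    unfolding is_computation_snoc using reach that is_npltsD(1)[OF assms(1) that(1)] by metis
  have eq: "c = c'" if "is_computation Z r c" "is_computation Z r c'"
    "final_state r c = final_state r c'" for c c'
    using u that final_state_in_states[OF assms that(1)] by metis
  show ?root
  proof (intro allI impI notI)
    fix z a D assume "(z, a, D) \<in> transitions Z" "r \<in> set_pmf D"
    then obtain c where "is_computation Z r (c @ [(a, r)])" using path by blast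
    from eq[OF this, of "[]"] show False by simp
  qed
  show ?pred
  proof (intro allI impI)
    fix z a D z' a' D'
    assume t: "(z, a, D) \<in> transitions Z" "(z', a', D') \<in> transitions Z"
      and "set_pmf D \<inter> set_pmf D' \<noteq> {}"
    then obtain y where "y \<in> set_pmf D" "y \<in> set_pmf D'" by blast
    then obtain c c' where c: "is_computation Z r (c @ [(a, y)])" "final_state r c = z"
      "is_computation Z r (c' @ [(a', y)])" "final_state r c' = z'"
      using path t by meson
    from eq[OF c(1,3)] c(2,4) show "z = z' \<and> a = a'" by auto
  qed
next
  assume asm: "?reach \<and> ?root \<and> ?pred"
  note reach = asm[THEN conjunct1] and root = asm[THEN conjunct2, THEN conjunct1]
    and pred = asm[THEN conjunct2, THEN conjunct2]
  \<comment> \<open>Since no transition enters the root, only the empty computation ends there; this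
    settles the cases of the backward induction in which one of the two computations is
    empty.\<close>
  have return: "c = []" if "is_computation Z r c" "final_state r c = r" for c
    using that root
    by (cases c rule: rev_cases) (auto simp: is_computation_snoc)
  have "c = c'" if "is_computation Z r c" "is_computation Z r c'"
    "final_state r c = final_state r c'" for c c'
    using that
  proof (induction c arbitrary: c' rule: rev_induct)
    case Nil
    then show ?case using return[of c'] by simp
  next
    case (snoc x c)
    obtain a y where x: "x = (a, y)" by (cases x)
    have "c' \<noteq> []" using return[OF snoc.prems(1)] snoc.prems(3) by auto
    then obtain c'' a' where c': "c' = c'' @ [(a', y)]"
      using snoc.prems(3) by (cases c' rule: rev_cases) (auto simp: x)
    obtain D where D: "(final_state r c, a, D) \<in> transitions Z" "y \<in> set_pmf D"
      using snoc.prems(1) x by (auto simp: is_computation_snoc)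
    obtain D' where D': "(final_state r c'', a', D') \<in> transitions Z" "y \<in> set_pmf D'"
      using snoc.prems(2) c' by (auto simp: is_computation_snoc)
    have eq: "final_state r c = final_state r c'' \<and> a = a'"
      using pred[rule_format, OF D(1) D'(1)] D(2) D'(2) by blast
    then have "c = c''"
      using snoc.prems(1,2) by (intro snoc.IH) (auto simp: x c' is_computation_snoc)
    with eq show ?case by (simp add: x c')
  qed
  with reach show ?unique by metis
qed

section \<open>Resolutions\<close>

text \<open>The form in which the resolutions constructed below are verified: paths have to be
  exhibited, but never compared.\<close>

lemma is_resolution_iff:
  "is_resolution L x Z r corr \<longleftrightarrow>
     is_nplts Z \<and> actions Z = actions L \<and> r \<in> states Z \<and>
     corr ` states Z \<subseteq> states L \<and> corr r = x \<and>
     (\<forall>z\<in>states Z. \<exists>c. is_computation Z r c \<and> final_state r c = z) \<and>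
     (\<forall>z a D. (z, a, D) \<in> transitions Z \<longrightarrow> r \<notin> set_pmf D) \<and>
     (\<forall>z a D z' a' D'. (z, a, D) \<in> transitions Z \<longrightarrow> (z', a', D') \<in> transitions Z \<longrightarrow>
        set_pmf D \<inter> set_pmf D' \<noteq> {} \<longrightarrow> z = z' \<and> a = a') \<and>
     (\<forall>z a D. (z, a, D) \<in> transitions Z \<longrightarrow>
        (\<exists>D'. (corr z, a, D') \<in> transitions L \<and>
              bij_betw corr (set_pmf D) (set_pmf D') \<and>
              (\<forall>z'\<in>set_pmf D. pmf D z' = pmf D' (corr z')))) \<and>
     (\<forall>z a D a' D'. (z, a, D) \<in> transitions Z \<longrightarrow> (z, a', D') \<in> transitions Z \<longrightarrow>
        a = a' \<and> D = D')"
proof (cases "is_nplts Z \<and> r \<in> states Z")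
  case True
  then show ?thesis
    unfolding is_resolution_def by (simp only: unique_computation_iff conj_assoc)
next
  case False
  then show ?thesis unfolding is_resolution_def by blast
qed

lemma ResD:
  assumes "(Z, r, corr) \<in> Res L x"
  shows "is_nplts Z" "actions Z = actions L" "r \<in> states Z" "corr ` states Z \<subseteq> states L"
    "corr r = x"
    "\<And>z. z \<in> states Z \<Longrightarrow> \<exists>!c. is_computation Z r c \<and> final_state r c = z"
    "\<And>z a D. (z, a, D) \<in> transitions Z \<Longrightarrow> r \<notin> set_pmf D"
    "\<And>z a D z' a' D'. (z, a, D) \<in> transitions Z \<Longrightarrow> (z', a', D') \<in> transitions Z \<Longrightarrow>
        set_pmf D \<inter> set_pmf D' \<noteq> {} \<Longrightarrow> z = z' \<and> a = a'"
    "\<And>z a D. (z, a, D) \<in> transitions Z \<Longrightarrow>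
        \<exists>D'. (corr z, a, D') \<in> transitions L \<and> bij_betw corr (set_pmf D) (set_pmf D') \<and>
             (\<forall>z'\<in>set_pmf D. pmf D z' = pmf D' (corr z'))"
    "\<And>z a D a' D'. (z, a, D) \<in> transitions Z \<Longrightarrow> (z, a', D') \<in> transitions Z \<Longrightarrow>
        a = a' \<and> D = D'"
proof -
  have 1: "is_resolution L x Z r corr" using assms by (simp add: Res_def)
  then show "is_nplts Z" "actions Z = actions L" "r \<in> states Z" "corr ` states Z \<subseteq> states L"
    "corr r = x"
    "\<And>z. z \<in> states Z \<Longrightarrow> \<exists>!c. is_computation Z r c \<and> final_state r c = z"
    by (simp_all add: is_resolution_def)
  show "\<And>z a D. (z, a, D) \<in> transitions Z \<Longrightarrow> r \<notin> set_pmf D"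
    "\<And>z a D z' a' D'. (z, a, D) \<in> transitions Z \<Longrightarrow> (z', a', D') \<in> transitions Z \<Longrightarrow>
        set_pmf D \<inter> set_pmf D' \<noteq> {} \<Longrightarrow> z = z' \<and> a = a'"
    "\<And>z a D. (z, a, D) \<in> transitions Z \<Longrightarrow>
        \<exists>D'. (corr z, a, D') \<in> transitions L \<and> bij_betw corr (set_pmf D) (set_pmf D') \<and>
             (\<forall>z'\<in>set_pmf D. pmf D z' = pmf D' (corr z'))"
    "\<And>z a D a' D'. (z, a, D) \<in> transitions Z \<Longrightarrow> (z, a', D') \<in> transitions Z \<Longrightarrow>
        a = a' \<and> D = D'"
    using 1 unfolding is_resolution_iff by blast+
qed

lemma comp_prob_Cons_Res:
  assumes "(Z, r, corr) \<in> Res L x" "(z, a, D) \<in> transitions Z"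
  shows "comp_prob Z z ((a, y) # c) = pmf D y * comp_prob Z y c"
  using ResD(10)[OF assms(1)] assms(2) by (intro comp_prob_Cons) blast+

text \<open>An extension can add nothing at a state that already moves, by determinism, nor at one
  whose original is stuck. As all states of the extension are reachable from its root, it has no
  states outside the image of \<open>h\<close>.\<close>

lemma Res_max_if_no_early_stop:
  assumes R: "(Z, r, corr) \<in> Res L x"
    and moves: "\<And>z a D. z \<in> states Z \<Longrightarrow> (corr z, a, D) \<in> transitions L \<Longrightarrow>
      \<exists>b E. (z, b, E) \<in> transitions Z"
  shows "(Z, r, corr) \<in> Res_max L x"
proof -
  have "Z' = rename_states h Z"
    if R': "(Z', r', corr') \<in> Res L x" and ext: "extends_via h (Z, r, corr) (Z', r', corr')"
    for Z' r' corr' h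
  proof -
    have h: "h r = r'" "\<And>y. y \<in> states Z \<Longrightarrow> corr' (h y) = corr y"
      "h ` states Z \<subseteq> states Z'"
      and tr: "\<And>z a D. (z, a, D) \<in> transitions Z \<Longrightarrow> (h z, a, map_pmf h D) \<in> transitions Z'"
      using ext by (force simp: rename_states_def)+
    \<comment> \<open>A transition of \<open>Z'\<close> at \<open>h z\<close> stems from one at
      \<open>corr z\<close>, so \<open>moves\<close> yields a transition of \<open>Z\<close> at
      \<open>z\<close>. The image of the latter also leaves \<open>h z\<close> in \<open>Z'\<close>,
      and determinism of \<open>Z'\<close> identifies the two.\<close>
    have step: "\<exists>E. (z, a, E) \<in> transitions Z \<and> D = map_pmf h E"
      if z: "z \<in> states Z" and D: "(h z, a, D) \<in> transitions Z'" for z a D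
    proof -
      obtain b E where E: "(z, b, E) \<in> transitions Z"
        using ResD(9)[OF R' D] moves[OF z] h(2)[OF z] by metis
      with ResD(10)[OF R' D tr[OF E]] show ?thesis by blast
    qed
    have comp: "final_state y c \<in> h ` states Z"
      if "is_computation Z' y c" "y \<in> h ` states Z" for y c
      using that
    proof (induction c arbitrary: y)
      case (Cons p c)
      obtain a y' where p: "p = (a, y')" by (cases p)
      obtain z D where z: "z \<in> states Z" "y = h z" "(h z, a, D) \<in> transitions Z'" "y' \<in> set_pmf D"
        using Cons.prems by (auto simp: p)
      then obtain E where "(z, a, E) \<in> transitions Z" "D = map_pmf h E"
        using step by blast
      then have "y' \<in> h ` states Z"
        using z is_npltsD(3)[OF ResD(1)[OF R]] by fastforce
      then show ?case using Cons by (simp add: p)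
    qed simp
    have states: "states Z' = h ` states Z"
    proof (intro equalityI subsetI)
      fix y assume "y \<in> states Z'"
      then obtain c where "is_computation Z' r' c" "final_state r' c = y"
        using ResD(6)[OF R'] by blast
      then show "y \<in> h ` states Z" using comp[of r' c] h(1) ResD(3)[OF R] by blast
    qed (use h(3) in blast)
    have "transitions Z' = (\<lambda>(z, a, D). (h z, a, map_pmf h D)) ` transitions Z"
    proof (intro equalityI subsetI)
      fix t assume t: "t \<in> transitions Z'"
      obtain y a D where t': "t = (y, a, D)" by (cases t) auto
      with t is_npltsD(1)[OF ResD(1)[OF R']] states obtain z where "z \<in> states Z" "y = h z"
        by blast
      with step t t' show "t \<in> (\<lambda>(z, a, D). (h z, a, map_pmf h D)) ` transitions Z"
        by (force simp: image_iff)
    qed (use tr in auto)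
    with states show ?thesis
      using ResD(2)[OF R] ResD(2)[OF R'] by (simp add: rename_states_def)
  qed
  with R show ?thesis by (auto simp: Res_max_def)
qed

section \<open>The test for a trace\<close>

text \<open>The dead state is \<open>Suc (length \<alpha>)\<close>: it differs from the success
  state \<open>length \<alpha>\<close> even at the last step, and every transition increases the
  number of the state, which gives acyclicity.\<close>

definition trace_test :: "'a set \<Rightarrow> 'a list \<Rightarrow> (nat, 'a) nplts" where
  "trace_test A \<alpha> = \<lparr>states = {0..Suc (length \<alpha>)}, actions = A,
     transitions = {(i, \<alpha> ! i, return_pmf j) | i j. i < length \<alpha> \<and> (j = Suc i \<or> j = Suc (length \<alpha>))}\<rparr>"

lemma trace_test_simps [simp]:
  "states (trace_test A \<alpha>) = {0..Suc (length \<alpha>)}"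
  "actions (trace_test A \<alpha>) = A"
  "(i, a, D) \<in> transitions (trace_test A \<alpha>) \<longleftrightarrow>
     i < length \<alpha> \<and> a = \<alpha> ! i \<and> (D = return_pmf (Suc i) \<or> D = return_pmf (Suc (length \<alpha>)))"
  by (auto simp: trace_test_def)

lemma is_npt_trace_test:
  assumes "countable A" "\<alpha> \<in> lists A"
  shows "is_npt (trace_test A \<alpha>) (length \<alpha>)"
proof -
  have "transitions (trace_test A \<alpha>) \<subseteq>
      (\<lambda>(i, j). (i, \<alpha> ! i, return_pmf j)) ` ({..<length \<alpha>} \<times> {0..Suc (length \<alpha>)})"
    by (auto simp: trace_test_def)
  then have "finite (transitions (trace_test A \<alpha>))"
    by (rule finite_subset) auto
  moreover have "acyclic {(q, q'). \<exists>a D. (q, a, D) \<in> transitions (trace_test A \<alpha>) \<and> q' \<in> set_pmf D}"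
    by (rule acyclic_subset[OF wf_acyclic[OF wf_less_than]]) auto
  moreover have "is_nplts (trace_test A \<alpha>)"
    using assms by (auto simp: is_nplts_def)
  ultimately show ?thesis by (auto simp: is_npt_def)
qed

lemma interaction_simps [simp]:
  "states (interaction L T) = states L \<times> states T"
  "actions (interaction L T) = actions L"
  "((s, q), a, D) \<in> transitions (interaction L T) \<longleftrightarrow>
     (\<exists>D\<^sub>1 D\<^sub>2. (s, a, D\<^sub>1) \<in> transitions L \<and> (q, a, D\<^sub>2) \<in> transitions T \<and> D = pair_pmf D\<^sub>1 D\<^sub>2)"
  by (auto simp: interaction_def)

lemma pmf_pair_return: "pmf (pair_pmf D (return_pmf k)) (s, k) = pmf D s"
  by (simp add: pmf_pair)

section \<open>From the interaction system to the process\<close>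

text \<open>A successful computation never enters the dead state of the test, so cutting the moves
  into it loses no success. What remains projects to the process, and reaching position
  \<open>length \<alpha>\<close> means having performed all of \<open>\<alpha>\<close>.\<close>

lemma Res_of_Res_interaction:
  assumes R: "(R, r, cr) \<in> Res (interaction L (trace_test A \<alpha>)) (x, 0)"
  obtains Z where "(Z, r, fst \<circ> cr) \<in> Res L x"
    "prob Z r (CC Z r \<alpha>) = prob R r (SC R r cr (length \<alpha>))"
proof -
  let ?n = "length \<alpha>"
  define Z where "Z = \<lparr>states = {z \<in> states R. snd (cr z) \<noteq> Suc ?n}, actions = actions R,
    transitions = {(z, a, D) \<in> transitions R. \<forall>y\<in>set_pmf D. snd (cr y) \<noteq> Suc ?n}\<rparr>"
  have Z [simp]: "states Z = {z \<in> states R. snd (cr z) \<noteq> Suc ?n}" "actions Z = actions R"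
    "(z, a, D) \<in> transitions Z \<longleftrightarrow>
      (z, a, D) \<in> transitions R \<and> (\<forall>y\<in>set_pmf D. snd (cr y) \<noteq> Suc ?n)" for z a D
    by (auto simp: Z_def)
  note nR = is_npltsD[OF ResD(1)[OF R]]
  \<comment> \<open>The distributions of the test are Dirac, so one test position \<open>j\<close>
    is shared by all successors. Hence dropping the test component is injective on them, and either
    all of them are dead or none is.\<close>
  have tr: "snd (cr z) < ?n \<and> a = \<alpha> ! snd (cr z) \<and> (\<exists>D\<^sub>1 j. (fst (cr z), a, D\<^sub>1) \<in> transitions L \<and>
      (j = Suc (snd (cr z)) \<or> j = Suc ?n) \<and> (\<forall>y\<in>set_pmf D. snd (cr y) = j) \<and>
      bij_betw (fst \<circ> cr) (set_pmf D) (set_pmf D\<^sub>1) \<and>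
      (\<forall>y\<in>set_pmf D. pmf D y = pmf D\<^sub>1 (fst (cr y))))"
    if t: "(z, a, D) \<in> transitions R" for z a D
  proof -
    obtain s i where si: "cr z = (s, i)" by force
    obtain D' where D': "(cr z, a, D') \<in> transitions (interaction L (trace_test A \<alpha>))"
      "bij_betw cr (set_pmf D) (set_pmf D')" "\<And>y. y \<in> set_pmf D \<Longrightarrow> pmf D y = pmf D' (cr y)"
      using ResD(9)[OF R t] by blast
    then obtain D\<^sub>1 j where j: "(s, a, D\<^sub>1) \<in> transitions L" "i < ?n" "a = \<alpha> ! i"
      "j = Suc i \<or> j = Suc ?n" "D' = pair_pmf D\<^sub>1 (return_pmf j)"
      by (auto simp: si)
    have bij: "bij_betw cr (set_pmf D) (set_pmf D\<^sub>1 \<times> {j})"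
      using D'(2) by (simp add: j(5))
    then have y: "snd (cr y) = j" if "y \<in> set_pmf D" for y
      using that bij_betwE by fastforce
    have "bij_betw fst (set_pmf D\<^sub>1 \<times> {j}) (set_pmf D\<^sub>1)"
      by (auto simp: bij_betw_def inj_on_def)
    then have "bij_betw (fst \<circ> cr) (set_pmf D) (set_pmf D\<^sub>1)"
      using bij bij_betw_trans by blast
    moreover have "pmf D y = pmf D\<^sub>1 (fst (cr y))" if "y \<in> set_pmf D" for y
      using D'(3)[OF that] y[OF that] pmf_pair_return[of D\<^sub>1 j "fst (cr y)"]
      by (metis j(5) prod.collapse)
    ultimately show ?thesis using j y by (auto simp: si)
  qed
  have nZ: "is_nplts Z"
  proof -
    have "z \<in> states Z \<and> a \<in> actions Z \<and> set_pmf D \<subseteq> states Z" if "(z, a, D) \<in> transitions Z" for z a D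
      using that nR[of z a D] tr[of z a D] by auto
    moreover have "countable (states R)" "countable (actions Z)"
      using ResD(1)[OF R] by (simp_all add: is_nplts_def)
    ultimately show ?thesis by (auto simp: is_nplts_def simp del: Z(3))
  qed
  \<comment> \<open>The source of a transition is never dead, and a transition with one target that
    is not dead has no dead target; so the whole computation survives the cut.\<close>
  have reach: "is_computation Z r c"
    if "is_computation R r c" "snd (cr (final_state r c)) \<noteq> Suc ?n" for c
    using that
  proof (induction c rule: rev_induct)
    case (snoc p c)
    obtain a y where p: "p = (a, y)" by (cases p)
    obtain D where D: "(final_state r c, a, D) \<in> transitions R" "y \<in> set_pmf D"
      using snoc.prems(1) by (auto simp: p is_computation_snoc)
    with tr[OF D(1)] snoc show ?case by (fastforce simp: p is_computation_snoc)
  qed simp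
  have Res: "(Z, r, fst \<circ> cr) \<in> Res L x"
  proof -
    have "\<exists>c. is_computation Z r c \<and> final_state r c = z" if "z \<in> states Z" for z
      using ResD(6)[OF R, of z] that reach by auto
    moreover have "(fst \<circ> cr) ` states Z \<subseteq> states L"
      using ResD(4)[OF R] by force
    moreover have "\<exists>D'. ((fst \<circ> cr) z, a, D') \<in> transitions L \<and>
        bij_betw (fst \<circ> cr) (set_pmf D) (set_pmf D') \<and>
        (\<forall>z'\<in>set_pmf D. pmf D z' = pmf D' ((fst \<circ> cr) z'))"
      if "(z, a, D) \<in> transitions Z" for z a D
      using tr[of z a D] that by auto
    moreover have "(z, a, D) \<in> transitions R" if "(z, a, D) \<in> transitions Z" for z a D
      using that by simp
    moreover have "actions Z = actions L" "r \<in> states Z" "(fst \<circ> cr) r = x"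
      using ResD(2,3,5)[OF R] by simp_all
    ultimately have "is_resolution L x Z r (fst \<circ> cr)"
      unfolding is_resolution_iff
      using nZ ResD(7)[OF R] ResD(8)[OF R] ResD(10)[OF R]
      by (intro conjI allI ballI impI) metis+
    then show ?thesis by (simp add: Res_def)
  qed
  \<comment> \<open>Generalised from the root to any state that is not dead, for the induction: what
    remains to be performed at \<open>z\<close> is the suffix of \<open>\<alpha>\<close> from its
    test position on.\<close>
  have CC_SC: "is_computation Z z c \<and> map fst c = drop (snd (cr z)) \<alpha> \<longleftrightarrow>
      is_computation R z c \<and> snd (cr (final_state z c)) = ?n"
    if "snd (cr z) \<le> ?n" for z c
    using that
  proof (induction c arbitrary: z)
    case Nil
    then show ?case by auto
  next
    case (Cons p c)
    obtain a y where p: "p = (a, y)" by (cases p)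
    have "is_computation Z y c \<and> map fst (p # c) = drop (snd (cr z)) \<alpha> \<and>
        (\<forall>y\<in>set_pmf D. snd (cr y) \<noteq> Suc ?n) \<longleftrightarrow>
      is_computation R y c \<and> snd (cr (final_state y c)) = ?n"
      if D: "(z, a, D) \<in> transitions R" "y \<in> set_pmf D" for D
    \<comment> \<open>If \<open>y\<close> is dead, both sides are false: nothing leaves
      \<open>y\<close>, so a computation of \<open>R\<close> from it is empty and ends at position
      \<open>Suc ?n\<close> instead of \<open>?n\<close>.\<close>
    proof (cases "snd (cr y) = Suc ?n")
      case True
      then have "(y, b, E) \<notin> transitions R" for b E using tr[of y b E] by auto
      then have "c = []" if "is_computation R y c"
        using that by (cases c) auto
      with True D(2) show ?thesis by auto
    next
      case False
      with tr[OF D(1)] D(2) have y: "snd (cr y) = Suc (snd (cr z))" "snd (cr z) < ?n"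
        "\<forall>y\<in>set_pmf D. snd (cr y) \<noteq> Suc ?n" and a: "a = \<alpha> ! snd (cr z)"
        by metis+
      have "drop (snd (cr z)) \<alpha> = a # drop (snd (cr y)) \<alpha>"
        using Cons_nth_drop_Suc[OF y(2)] by (simp only: a y(1))
      with Cons.IH[of y] y show ?thesis by (simp add: p)
    qed
    then show ?case by (auto simp: p)
  qed
  have r: "snd (cr r) = 0" using ResD(5)[OF R] by simp
  have CC: "CC Z r \<alpha> = SC R r cr ?n"
    using CC_SC[of r] r by (auto simp: CC_def SC_def compatible_def prod_eq_iff)
  have "comp_prob Z z c = comp_prob R z c" if "is_computation Z z c" for z c
    using that
  proof (induction c arbitrary: z)
    case (Cons p c)
    obtain a y where p: "p = (a, y)" by (cases p)
    obtain D where "(z, a, D) \<in> transitions Z" using Cons.prems by (auto simp: p)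
    moreover from this have "(z, a, D) \<in> transitions R" by simp
    ultimately show ?case
      using Cons comp_prob_Cons_Res[OF Res] comp_prob_Cons_Res[OF R] by (simp add: p del: comp_prob.simps Z)
  qed simp
  then have "prob Z r (CC Z r \<alpha>) = prob R r (SC R r cr ?n)"
    unfolding prob_def CC[symmetric] by (intro infsum_cong) (auto simp: CC_def)
  with Res show thesis by (rule that)
qed

section \<open>From the process to a maximal resolution of the interaction system\<close>

text \<open>The part of \<open>Z\<close> that follows \<open>\<alpha>\<close> is kept. Where
  \<open>Z\<close> does not perform the next action although the process can, a move with the test
  going to its dead state is added; this achieves maximality without creating any success.\<close>

lemma Res_max_interaction_of_Res:
  assumes L: "is_nplts L" and \<alpha>: "\<alpha> \<in> lists (actions L)"
    and Z: "(Z, r, corr) \<in> Res L x"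
  obtains R r' cr where "(R, r', cr) \<in> Res_max (interaction L (trace_test (actions L) \<alpha>)) (x, 0)"
    "prob R r' (SC R r' cr (length \<alpha>)) = prob Z r (CC Z r \<alpha>)"
proof -
  let ?n = "length \<alpha>" and ?I = "interaction L (trace_test (actions L) \<alpha>)"
  note nZ = is_npltsD[OF ResD(1)[OF Z]]
  define path where "path z = (THE c. is_computation Z r c \<and> final_state r c = z)" for z
  have path: "is_computation Z r (path z)" "final_state r (path z) = z" if "z \<in> states Z" for z
    using theI'[OF ResD(6)[OF Z that]] by (auto simp: path_def)
  have path_eq: "path z = c" if "is_computation Z r c" "final_state r c = z" for z c
    using the1_equality[OF ResD(6)[OF Z], of z c] final_state_in_states[OF ResD(1,3)[OF Z]] that
    by (auto simp: path_def)
  \<comment> \<open>In a tree the depth of a state is determined, so it can serve as the position of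
    the test.\<close>
  define depth where "depth z = length (path z)" for z
  \<comment> \<open>\<open>V\<close> consists of the states reached by performing a prefix of
    \<open>\<alpha>\<close>.\<close>
  define V where "V = {z \<in> states Z. depth z \<le> ?n \<and> map fst (path z) = take (depth z) \<alpha>}"
  have V: "V \<subseteq> states Z" "\<And>z. z \<in> V \<Longrightarrow> depth z \<le> ?n" by (auto simp: V_def)
  have r: "r \<in> V" "depth r = 0"
    using path_eq[of "[]" r] ResD(3)[OF Z] by (auto simp: V_def depth_def)
  have path_step: "path y = path z @ [(a, y)]"
    if "(z, a, D) \<in> transitions Z" "y \<in> set_pmf D" for z a D y
    using path[OF nZ(1)[OF that(1)]] that by (intro path_eq) (auto simp: is_computation_snoc)
  have step: "y \<in> V" "depth y = Suc (depth z)"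
    if "z \<in> V" "depth z < ?n" "(z, \<alpha> ! depth z, D) \<in> transitions Z" "y \<in> set_pmf D" for z D y
    using that path_step[OF that(3,4)] nZ(3)[OF that(3)]
    by (auto simp: V_def depth_def take_Suc_conv_app_nth)

  text \<open>Even numbers encode the states of \<open>Z\<close>; the odd number \<open>f z s\<close> encodes the state reached when
    the test is sent to its dead state from \<open>z\<close> while the process moves to \<open>s\<close>.\<close>
  define e :: "nat \<Rightarrow> nat" where "e z = 2 * z" for z
  define f where "f z s = Suc (2 * prod_encode (z, to_nat_on (states L) s))" for z s
  define cr where "cr k = (if even k then (corr (k div 2), depth (k div 2))
    else (from_nat_into (states L) (snd (prod_decode (k div 2))), Suc ?n))" for k
  have cS: "countable (states L)" using L by (simp add: is_nplts_def)
  have e: "inj e" "\<And>z. cr (e z) = (corr z, depth z)" "\<And>z y. e z = e y \<longleftrightarrow> z = y"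
    by (auto simp: e_def cr_def inj_def)
  have ef: "e z \<noteq> f y s" "f y s \<noteq> e z" for z y s
    unfolding e_def f_def by presburger+
  have crf: "cr (f z s) = (s, Suc ?n)" if "s \<in> states L" for z s
    using that cS by (simp add: f_def cr_def)
  have f_inj: "z = z' \<and> s = s'"
    if "f z s = f z' s'" "s \<in> states L" "s' \<in> states L" for z s z' s'
    using that cS by (auto simp: f_def)

  \<comment> \<open>\<open>Z\<close> stops or deviates at \<open>z\<close> although the process can
    perform the next action. \<open>SOME\<close> fixes a single such transition of the process, as a
    resolution must be deterministic.\<close>
  define fail where "fail z D \<longleftrightarrow> z \<in> V \<and> depth z < ?n \<and> (\<forall>D. (z, \<alpha> ! depth z, D) \<notin> transitions Z) \<and>
    (\<exists>D. (corr z, \<alpha> ! depth z, D) \<in> transitions L) \<and>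
    D = (SOME D. (corr z, \<alpha> ! depth z, D) \<in> transitions L)" for z D
  have fail: "(corr z, \<alpha> ! depth z, D) \<in> transitions L" if "fail z D" for z D
    using that someI_ex unfolding fail_def by metis
  have failS: "set_pmf D \<subseteq> states L" if "fail z D" for z D
    using is_npltsD(3)[OF L fail[OF that]] .
  have failV: "z \<in> V" "depth z < ?n" if "fail z D" for z D
    using that by (auto simp: fail_def)
  define R where "R = \<lparr>states = e ` V \<union> {f z s | z s D. fail z D \<and> s \<in> set_pmf D},
    actions = actions L,
    transitions = {(e z, \<alpha> ! depth z, map_pmf e D) | z D.
        z \<in> V \<and> depth z < ?n \<and> (z, \<alpha> ! depth z, D) \<in> transitions Z} \<union>
      {(e z, \<alpha> ! depth z, map_pmf (f z) D) | z D. fail z D}\<rparr>"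
  have R_states: "states R = e ` V \<union> {f z s | z s D. fail z D \<and> s \<in> set_pmf D}"
    and R_actions: "actions R = actions L" by (simp_all add: R_def)
  have R_e: "(e z, a, E) \<in> transitions R \<longleftrightarrow> a = \<alpha> ! depth z \<and> z \<in> V \<and> depth z < ?n \<and>
      ((\<exists>D. (z, a, D) \<in> transitions Z \<and> E = map_pmf e D) \<or> (\<exists>D. fail z D \<and> E = map_pmf (f z) D))"
    for z a E
    using failV by (auto simp: R_def e(3))
  have R_f: "(f z s, a, E) \<notin> transitions R" for z s a E
    by (auto simp: R_def ef)
  have R_cases: "\<exists>z. k = e z \<and> z \<in> V \<and> depth z < ?n \<and> a = \<alpha> ! depth z \<and>
      ((\<exists>D. (z, a, D) \<in> transitions Z \<and> E = map_pmf e D) \<or> (\<exists>D. fail z D \<and> E = map_pmf (f z) D))"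
    if "(k, a, E) \<in> transitions R" for k a E
    using that failV by (auto simp: R_def)
  \<comment> \<open>The two kinds of transitions never leave the same state, because
    \<open>fail\<close> demands that \<open>Z\<close> does not perform the expected action
    there.\<close>
  have det: "a = a' \<and> E = E'" if t: "(k, a, E) \<in> transitions R" "(k, a', E') \<in> transitions R"
    for k a E a' E'
  proof -
    obtain z where k: "k = e z" using R_cases[OF t(1)] by blast
    have "D = D'" if "(z, a, D) \<in> transitions Z" "(z, a, D') \<in> transitions Z" for D D' a
      using ResD(10)[OF Z that] by simp
    moreover have "D = D'" if "fail z D" "fail z D'" for D D'
      using that by (simp add: fail_def)
    moreover have "(z, \<alpha> ! depth z, D) \<notin> transitions Z" if "fail z D'" for D D'
      using that by (simp add: fail_def)
    ultimately show ?thesis using t unfolding k R_e by metis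
  qed
  have nR: "is_nplts R"
  proof -
    have "k \<in> states R \<and> a \<in> actions R \<and> set_pmf E \<subseteq> states R"
      if t: "(k, a, E) \<in> transitions R" for k a E
    proof -
      obtain z where z: "k = e z" "z \<in> V" "depth z < ?n" "a = \<alpha> ! depth z"
        "(\<exists>D. (z, a, D) \<in> transitions Z \<and> E = map_pmf e D) \<or> (\<exists>D. fail z D \<and> E = map_pmf (f z) D)"
        using R_cases[OF t] by blast
      have "a \<in> actions L" using \<alpha> z(3,4) by auto
      moreover have "set_pmf E \<subseteq> states R"
        using z(5) step(1)[OF z(2,3)] unfolding R_states z(4) by fastforce
      ultimately show ?thesis using z by (auto simp: R_states R_actions)
    qed
    moreover have "countable (actions R)" using L by (simp add: R_actions is_nplts_def)
    ultimately show ?thesis by (auto simp: is_nplts_def)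
  qed
  have reach_e: "\<exists>c. is_computation R (e r) c \<and> final_state (e r) c = e z" if "z \<in> V" for z
  proof -
    have "\<exists>d. is_computation R (e r) d \<and> final_state (e r) d = e (final_state r c)"
      if "is_computation Z r c" "final_state r c \<in> V" for c
      using that
    proof (induction c rule: rev_induct)
      case Nil
      show ?case by (rule exI[of _ "[]"]) simp
    next
      case (snoc p c)
      obtain a y where p: "p = (a, y)" by (cases p)
      let ?z = "final_state r c"
      obtain D where D: "(?z, a, D) \<in> transitions Z" "y \<in> set_pmf D" and c: "is_computation Z r c"
        using snoc.prems by (auto simp: p is_computation_snoc)
      have py: "path y = c @ [(a, y)]" "path ?z = c"
        using path_step[OF D] path_eq[OF c] by auto
      \<comment> \<open>\<open>V\<close> is closed under predecessors: the path to \<open>y\<close>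
        spells a prefix of \<open>\<alpha>\<close>, hence so does its initial part leading to
        \<open>?z\<close>.\<close>
      have z: "?z \<in> V" "depth ?z < ?n" "a = \<alpha> ! depth ?z"
        using snoc.prems(2) nZ(1)[OF D(1)] py
        by (auto simp: V_def p depth_def take_Suc_conv_app_nth Suc_le_eq)
      obtain d where d: "is_computation R (e r) d" "final_state (e r) d = e ?z"
        using snoc.IH c z(1) by blast
      have "(e ?z, a, map_pmf e D) \<in> transitions R" "e y \<in> set_pmf (map_pmf e D)"
        using z D by (auto simp: R_e)
      then show ?case using d
        by (intro exI[of _ "d @ [(a, e y)]"]) (auto simp: is_computation_snoc p simp del: set_map_pmf)
    qed
    from this[OF path(1)] path(2) that V(1) show ?thesis by (metis subsetD)
  qed
  have Res: "(R, e r, cr) \<in> Res ?I (x, 0)"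
  proof -
    have "\<exists>c. is_computation R (e r) c \<and> final_state (e r) c = k" if "k \<in> states R" for k
    proof (cases "k \<in> e ` V")
      case True
      then show ?thesis using reach_e by blast
    next
      case False
      then obtain z s D where z: "k = f z s" "fail z D" "s \<in> set_pmf D"
        using \<open>k \<in> states R\<close> by (auto simp: R_states)
      obtain c where c: "is_computation R (e r) c" "final_state (e r) c = e z"
        using reach_e failV(1)[OF z(2)] by blast
      have "(e z, \<alpha> ! depth z, map_pmf (f z) D) \<in> transitions R" "k \<in> set_pmf (map_pmf (f z) D)"
        using z failV by (auto simp: R_e)
      with c show ?thesis
        by (intro exI[of _ "c @ [(\<alpha> ! depth z, k)]"]) (auto simp: is_computation_snoc simp del: set_map_pmf)
    qed
    moreover have "e r \<notin> set_pmf E" if "(k, a, E) \<in> transitions R" for k a E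
      using R_cases[OF that] ResD(7)[OF Z] by (auto simp: ef e(3))
    \<comment> \<open>Kept transitions inherit this from \<open>Z\<close>. The targets of added
      transitions from different states are distinct because \<open>f z s\<close> records
      \<open>z\<close>, and mixed pairs are separated by parity.\<close>
    moreover have "k = k' \<and> a = a'" if t: "(k, a, E) \<in> transitions R" "(k', a', E') \<in> transitions R"
      and ne: "set_pmf E \<inter> set_pmf E' \<noteq> {}" for k a E k' a' E'
    proof -
      obtain z z' where k: "k = e z" "k' = e z'" using R_cases t by metis
      have "z = z' \<and> a = a'" if "(z, a, D) \<in> transitions Z" "E = map_pmf e D"
        "(z', a', D') \<in> transitions Z" "E' = map_pmf e D'" for D D'
        using ResD(8)[OF Z that(1,3)] ne that(2,4) e(3) by fastforce
      moreover have "z = z'" if "fail z D" "E = map_pmf (f z) D" "fail z' D'" "E' = map_pmf (f z') D'" for D D'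
        using ne f_inj failS[OF that(1)] failS[OF that(3)] that(2,4) by (simp, blast)
      moreover have False if "E = map_pmf e D" "E' = map_pmf (f y) D'" for D D' y
        using ne that ef by auto
      moreover have False if "E' = map_pmf e D" "E = map_pmf (f y) D'" for D D' y
        using ne that ef by auto
      ultimately have "z = z' \<and> a = a'" using t unfolding k R_e by metis
      then show ?thesis by (simp add: k)
    qed
    \<comment> \<open>A kept transition is matched with the test advancing by one position, an added
      one with the test moving to its dead state.\<close>
    moreover have "\<exists>D'. (cr k, a, D') \<in> transitions ?I \<and> bij_betw cr (set_pmf E) (set_pmf D') \<and>
        (\<forall>y\<in>set_pmf E. pmf E y = pmf D' (cr y))"
      if t: "(k, a, E) \<in> transitions R" for k a E
    proof -
      obtain z where z: "k = e z" "z \<in> V" "depth z < ?n" "a = \<alpha> ! depth z"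
        "(\<exists>D. (z, a, D) \<in> transitions Z \<and> E = map_pmf e D) \<or> (\<exists>D. fail z D \<and> E = map_pmf (f z) D)"
        using R_cases[OF t] by blast
      from z(5) show ?thesis
      proof (elim disjE exE conjE)
        fix D assume D: "(z, a, D) \<in> transitions Z" "E = map_pmf e D"
        obtain D' where D': "(corr z, a, D') \<in> transitions L" "bij_betw corr (set_pmf D) (set_pmf D')"
          "\<forall>y\<in>set_pmf D. pmf D y = pmf D' (corr y)"
          using ResD(9)[OF Z D(1)] by blast
        have dy: "depth y = Suc (depth z)" if "y \<in> set_pmf D" for y
          using step(2)[OF z(2,3)] D(1) that z(4) by blast
        let ?D = "pair_pmf D' (return_pmf (Suc (depth z)))"
        have "(cr k, a, ?D) \<in> transitions ?I"
          using D'(1) z by (auto simp: e(2))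
        moreover have "bij_betw cr (set_pmf E) (set_pmf ?D)"
          using D'(2) dy by (force simp: D(2) e(2) bij_betw_def inj_on_def image_iff)
        moreover have "\<forall>y\<in>set_pmf E. pmf E y = pmf ?D (cr y)"
          using D'(3) dy by (auto simp: D(2) e(2) pmf_map_inj'[OF e(1)] pmf_pair_return)
        ultimately show ?thesis by blast
      next
        fix D assume D: "fail z D" "E = map_pmf (f z) D"
        let ?D = "pair_pmf D (return_pmf (Suc ?n))"
        have inj: "inj_on (f z) (set_pmf D)"
          using f_inj failS[OF D(1)] unfolding inj_on_def by blast
        have crs: "cr (f z s) = (s, Suc ?n)" if "s \<in> set_pmf D" for s
          using crf failS[OF D(1)] that by blast
        have "(cr k, a, ?D) \<in> transitions ?I"
          using fail[OF D(1)] z by (auto simp: e(2))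
        moreover have "bij_betw cr (set_pmf E) (set_pmf ?D)"
          using crs by (force simp: D(2) bij_betw_def inj_on_def image_iff)
        moreover have "\<forall>y\<in>set_pmf E. pmf E y = pmf ?D (cr y)"
          using crs by (auto simp: D(2) pmf_map_inj[OF inj] pmf_pair_return)
        ultimately show ?thesis by blast
      qed
    qed
    moreover have "cr ` states R \<subseteq> states ?I"
    proof -
      have "corr z \<in> states L \<and> depth z \<le> Suc ?n" if "z \<in> V" for z
        using V(1) V(2)[OF that] ResD(4)[OF Z] that by auto
      moreover have "s \<in> states L" if "fail z D" "s \<in> set_pmf D" for z D s
        using failS that by blast
      ultimately show ?thesis by (auto simp: R_states e(2) crf)
    qed
    ultimately have "is_resolution ?I (x, 0) R (e r) cr"
      unfolding is_resolution_iff using nR R_actions r det ResD(5)[OF Z]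
      by (auto simp: e(2) R_states)
    then show ?thesis by (simp add: Res_def)
  qed
  \<comment> \<open>If the interaction system can move from the configuration of \<open>e z\<close>,
    then \<open>depth z < ?n\<close> and the process can perform the next action, so either
    \<open>Z\<close> performs it or \<open>fail\<close> applies. The states \<open>f z s\<close>
    correspond to configurations with a dead test, which cannot move.\<close>
  have max: "(R, e r, cr) \<in> Res_max ?I (x, 0)"
  proof (rule Res_max_if_no_early_stop[OF Res])
    fix k a D assume k: "k \<in> states R" "(cr k, a, D) \<in> transitions ?I"
    show "\<exists>b E. (k, b, E) \<in> transitions R"
    proof (cases "k \<in> e ` V")
      case True
      then obtain z where z: "k = e z" "z \<in> V" by blast
      with k(2) have z': "depth z < ?n" "\<exists>D. (corr z, \<alpha> ! depth z, D) \<in> transitions L"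
        by (auto simp: e(2))
      show ?thesis
      proof (cases "\<exists>D. (z, \<alpha> ! depth z, D) \<in> transitions Z")
        case True
        then show ?thesis using z z' by (auto simp: R_e)
      next
        case False
        then have "\<exists>D. fail z D" using z z' by (simp add: fail_def)
        then show ?thesis using z z' by (auto simp: R_e)
      qed
    next
      case False
      then obtain z s D' where "k = f z s" "fail z D'" "s \<in> set_pmf D'"
        using k(1) by (auto simp: R_states)
      then have "cr k = (s, Suc ?n)" using crf failS by blast
      with k(2) show ?thesis by auto
    qed
  qed
  \<comment> \<open>\<open>?g\<close> renames the states visited by a computation of
    \<open>Z\<close> to their even codes. The next two facts show that it maps the complete
    performances of \<open>\<alpha>\<close> onto the successful computations of
    \<open>R\<close>.\<close>
  let ?g = "map (apsnd e)"
  have CC_SC: "is_computation R (e z) (?g c) \<and> snd (cr (final_state (e z) (?g c))) = ?n \<and>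
      comp_prob R (e z) (?g c) = comp_prob Z z c"
    if "z \<in> V" "is_computation Z z c" "map fst c = drop (depth z) \<alpha>" for z c
    using that
  proof (induction c arbitrary: z)
    case Nil
    then show ?case using V(2)[of z] by (simp add: e(2))
  next
    case (Cons p c)
    obtain a y where p: "p = (a, y)" by (cases p)
    obtain D where D: "(z, a, D) \<in> transitions Z" "y \<in> set_pmf D" and c: "is_computation Z y c"
      using Cons.prems(2) by (auto simp: p)
    have dz: "depth z < ?n" using Cons.prems(3) by (cases "depth z < ?n") auto
    have "a # map fst c = \<alpha> ! depth z # drop (Suc (depth z)) \<alpha>"
      using Cons.prems(3) Cons_nth_drop_Suc[OF dz] by (simp only: p list.map fst_conv)
    then have a: "a = \<alpha> ! depth z" "map fst c = drop (Suc (depth z)) \<alpha>" by simp_all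
    note y = step[OF Cons.prems(1) dz D(1)[unfolded a(1)] D(2)]
    have t: "(e z, a, map_pmf e D) \<in> transitions R"
      unfolding R_e using a(1) Cons.prems(1) dz D(1) by blast
    have IH: "is_computation R (e y) (?g c)" "snd (cr (final_state (e y) (?g c))) = ?n"
      "comp_prob R (e y) (?g c) = comp_prob Z y c"
      using Cons.IH[OF y(1) c] y(2) a(2) by simp_all
    have "is_computation R (e z) (?g (p # c))"
      using IH(1) t D(2) by (auto simp: p intro!: exI[of _ "map_pmf e D"])
    moreover have "comp_prob R (e z) (?g (p # c)) = comp_prob Z z (p # c)"
      using IH(3)
      by (simp add: p comp_prob_Cons_Res[OF Res t] comp_prob_Cons_Res[OF Z D(1)]
          pmf_map_inj'[OF e(1)] del: comp_prob.simps)
    ultimately show ?case using IH(2) by (simp add: p)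
  qed
  have SC_CC: "\<exists>c. d = ?g c \<and> is_computation Z z c \<and> map fst c = drop (depth z) \<alpha>"
    if "z \<in> V" "is_computation R (e z) d" "snd (cr (final_state (e z) d)) = ?n" for z d
    using that
  proof (induction d arbitrary: z)
    case Nil
    then show ?case by (simp add: e(2))
  next
    case (Cons p d)
    obtain a k where p: "p = (a, k)" by (cases p)
    obtain E where E: "(e z, a, E) \<in> transitions R" "k \<in> set_pmf E" and d: "is_computation R k d"
      "snd (cr (final_state k d)) = ?n"
      using Cons.prems by (auto simp: p)
    have z: "a = \<alpha> ! depth z" "depth z < ?n" using E(1) by (auto simp: R_e)
    consider D where "(z, a, D) \<in> transitions Z" "E = map_pmf e D"
      | D where "fail z D" "E = map_pmf (f z) D"
      using E(1) by (auto simp: R_e)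
    then show ?case
    proof cases
      case (1 D)
      then obtain y where y: "k = e y" "y \<in> set_pmf D" using E(2) by auto
      have yV: "y \<in> V" "depth y = Suc (depth z)"
        using step[OF Cons.prems(1) z(2)] 1(1) y(2) z(1) by auto
      obtain c where "d = ?g c" "is_computation Z y c" "map fst c = drop (depth y) \<alpha>"
        using Cons.IH[OF yV(1)] d y(1) by blast
      then show ?thesis using 1 y yV z
        by (intro exI[of _ "(a, y) # c"]) (auto simp: p Cons_nth_drop_Suc)
    next
      \<comment> \<open>An added transition ends the computation at position \<open>Suc ?n\<close>,
        which contradicts success.\<close>
      case (2 D)
      then obtain s where s: "k = f z s" "s \<in> states L" using E(2) failS by auto
      then have "d = []" using d(1) R_f by (cases d) auto
      then show ?thesis using d(2) s by (simp add: crf)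
    qed
  qed
  have "SC R (e r) cr ?n = ?g ` CC Z r \<alpha>"
  proof (intro equalityI subsetI)
    fix d assume "d \<in> SC R (e r) cr ?n"
    then have "is_computation R (e r) d" "snd (cr (final_state (e r) d)) = ?n"
      by (auto simp: SC_def)
    from SC_CC[OF r(1) this] show "d \<in> ?g ` CC Z r \<alpha>"
      by (auto simp: CC_def compatible_def r(2))
  next
    fix d assume "d \<in> ?g ` CC Z r \<alpha>"
    then obtain c where c: "d = ?g c" "is_computation Z r c" "map fst c = \<alpha>"
      by (auto simp: CC_def compatible_def)
    from CC_SC[OF r(1) c(2)] c show "d \<in> SC R (e r) cr ?n"
      by (simp add: SC_def r(2) prod_eq_iff)
  qed
  moreover have "inj_on ?g (CC Z r \<alpha>)"
    using e(1) by (simp add: inj_on_def inj_def inj_map_eq_map prod_eq_iff)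
  ultimately have "prob R (e r) (SC R (e r) cr ?n) = (\<Sum>\<^sub>\<infinity>c\<in>CC Z r \<alpha>. comp_prob R (e r) (?g c))"
    by (simp only: prob_def infsum_reindex o_def)
  also have "\<dots> = prob Z r (CC Z r \<alpha>)"
    unfolding prob_def using CC_SC[OF r(1)] r(2)
    by (intro infsum_cong) (auto simp: CC_def compatible_def)
  finally show thesis using max that by blast
qed

theorem theorem4p7:
  fixes L :: "('s, 'a) nplts" and s\<^sub>1 s\<^sub>2 :: 's
  assumes "is_nplts L" and "s\<^sub>1 \<in> states L" and "s\<^sub>2 \<in> states L"
    and "PTe_forall_exists L s\<^sub>1 s\<^sub>2"
  shows "PTr L s\<^sub>1 s\<^sub>2"
proof -
  \<comment> \<open>Phrased for arbitrary \<open>s\<close> and \<open>s'\<close> with one direction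
    of the testing condition, so that it yields both conjuncts of \<open>PTr\<close> by exchanging
    the two states.\<close>
  have half: "\<forall>(Z, z, corr)\<in>Res L s. \<exists>(Z', z', corr')\<in>Res L s'.
      prob Z z (CC Z z \<alpha>) = prob Z' z' (CC Z' z' \<alpha>)"
    if \<alpha>: "\<alpha> \<in> lists (actions L)"
      and test: "\<And>(T :: (nat, 'a) nplts) \<omega> q. is_npt T \<omega> \<and> actions T = actions L \<and> q \<in> states T \<Longrightarrow>
        \<forall>(R, r, cr)\<in>Res_max (interaction L T) (s, q).
        \<exists>(R', r', cr')\<in>Res_max (interaction L T) (s', q).
          prob R r (SC R r cr \<omega>) = prob R' r' (SC R' r' cr' \<omega>)"
    for \<alpha> s s'
  proof clarify
    fix Z z corr assume Z: "(Z, z, corr) \<in> Res L s"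
    let ?T = "trace_test (actions L) \<alpha>"
    obtain R r cr where R: "(R, r, cr) \<in> Res_max (interaction L ?T) (s, 0)"
      "prob R r (SC R r cr (length \<alpha>)) = prob Z z (CC Z z \<alpha>)"
      using Res_max_interaction_of_Res[OF assms(1) \<alpha> Z] by blast
    have "is_npt ?T (length \<alpha>) \<and> actions ?T = actions L \<and> 0 \<in> states ?T"
      using is_npt_trace_test[OF _ \<alpha>] assms(1) by (simp add: is_nplts_def)
    \<comment> \<open>The test equivalence supplies a resolution for \<open>s'\<close> with the same
      success probability; cutting its dead moves gives the required resolution of the
      process.\<close>
    from test[OF this] R(1) obtain R' r' cr' where
      R': "(R', r', cr') \<in> Res (interaction L ?T) (s', 0)"
      "prob R r (SC R r cr (length \<alpha>)) = prob R' r' (SC R' r' cr' (length \<alpha>))"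
      unfolding Res_max_def by blast
    obtain Z' where "(Z', r', fst \<circ> cr') \<in> Res L s'"
      "prob Z' r' (CC Z' r' \<alpha>) = prob R' r' (SC R' r' cr' (length \<alpha>))"
      using Res_of_Res_interaction[OF R'(1)] by blast
    with R(2) R'(2) show "\<exists>(Z', z', corr')\<in>Res L s'. prob Z z (CC Z z \<alpha>) = prob Z' z' (CC Z' z' \<alpha>)"
      by (intro bexI[of _ "(Z', r', fst \<circ> cr')"]) auto
  qed
  show ?thesis
    unfolding PTr_def
  proof (rule ballI, rule conjI)
    fix \<alpha> assume \<alpha>: "\<alpha> \<in> lists (actions L)"
    note test = assms(4)[unfolded PTe_forall_exists_def, THEN spec, THEN spec, THEN spec, THEN mp]
    show "\<forall>(Z\<^sub>1, z\<^sub>1, corr\<^sub>1)\<in>Res L s\<^sub>1. \<exists>(Z\<^sub>2, z\<^sub>2, corr\<^sub>2)\<in>Res L s\<^sub>2.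
        prob Z\<^sub>1 z\<^sub>1 (CC Z\<^sub>1 z\<^sub>1 \<alpha>) = prob Z\<^sub>2 z\<^sub>2 (CC Z\<^sub>2 z\<^sub>2 \<alpha>)"
      by (rule half[OF \<alpha>]) (rule conjunct1[OF test])
    show "\<forall>(Z\<^sub>2, z\<^sub>2, corr\<^sub>2)\<in>Res L s\<^sub>2. \<exists>(Z\<^sub>1, z\<^sub>1, corr\<^sub>1)\<in>Res L s\<^sub>1.
        prob Z\<^sub>2 z\<^sub>2 (CC Z\<^sub>2 z\<^sub>2 \<alpha>) = prob Z\<^sub>1 z\<^sub>1 (CC Z\<^sub>1 z\<^sub>1 \<alpha>)"
      by (rule half[OF \<alpha>]) (rule conjunct2[OF test])
  qed
qed

end
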